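(* Let $f\in\mathbb{R}[x_1,\dots,x_n]$, and for axis-aligned $n$-dimensional cubes $J\subseteq\mathbb{R}^n$ let $C(J)$ be the predicate that is True if and only if $0\notin\square f(J)$. Let $J\subseteq\mathbb{R}^n$ be an axis-aligned $n$-dimensional cube. If there is a point $x\in J$ such that $$\operatorname{Diam}(J)\le\frac{2\sqrt{n}\,\ln\left(1+2^{2-2n}\right)\operatorname{dist}_{\mathbb{C}}(x,f)}{2^n\deg(f)+\sqrt{n}\,\ln\left(1+2^{2-2n}\right)},$$ then $C(J)$ is True. Therefore $C$ is a diameter-distance test: there is a positive constant $K$ (depending only on $n$ and $\deg f$) such that, for every such cube $J$, if $\operatorname{Diam}(J)<K\max_{x\in J}\operatorname{dist}_{\mathbb{C}}(x,f)$, then $C(J)$ is True.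
   Context: $\operatorname{dist}_{\mathbb{C}}(x,f)$ is the Euclidean distance in $\mathbb{C}^n$ from $x\in\mathbb{R}^n$ to the complex variety $V_{\mathbb{C}}(f)=\{z\in\mathbb{C}^n: f(z)=0\}$ (equal to $+\infty$ if $V_{\mathbb{C}}(f)=\emptyset$). $\operatorname{Diam}$ is the Euclidean diameter. Standard centered form: for an axis-aligned $n$-dimensional cube $J$ (a product of $n$ closed intervals of common width $w>0$) with midpoint $m$, and $f$ of total degree $D$, $$\square f(J)=f(m)+\left(\sum_{1\le|\alpha|\le D}\frac{|\partial^\alpha f(m)|}{\alpha!}\left(\frac{w}{2}\right)^{|\alpha|}\right)[-1,1],$$ where $\alpha\in\mathbb{N}^n$ and multi-index notation is used. *)

theory Defs
  imports "HOL-Analysis.Analysis" "HOL-Library.Poly_Mapping"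
begin

section \<open>Real polynomials in the variables indexed by a finite type\<close>

text \<open>
  A multi-index is a vector of type \<^typ>\<open>nat ^ 'n\<close>, and a polynomial is the finitely supported
  map sending each exponent to its coefficient.
\<close>

type_synonym 'n rpoly = "(nat, 'n) vec \<Rightarrow>\<^sub>0 real"

definition mi_degree :: "nat ^ 'n \<Rightarrow> nat" where
  "mi_degree \<alpha> = (\<Sum>i\<in>UNIV. \<alpha> $ i)"

definition mi_fact :: "nat ^ 'n \<Rightarrow> nat" where
  "mi_fact \<alpha> = (\<Prod>i\<in>UNIV. fact (\<alpha> $ i))"

text \<open>The zero polynomial gets degree 0.\<close>

definition total_degree :: "'n::finite rpoly \<Rightarrow> nat" where
  "total_degree f = Max (insert 0 (mi_degree ` Poly_Mapping.keys f))"

text \<open>Evaluation is used at real points and at complex points.\<close>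

definition eval_rpoly :: "'n::finite rpoly \<Rightarrow> 'a ^ 'n \<Rightarrow> 'a::{real_algebra_1, comm_ring_1}" where
  "eval_rpoly f x =
     (\<Sum>\<alpha>\<in>Poly_Mapping.keys f. of_real (Poly_Mapping.lookup f \<alpha>) * (\<Prod>i\<in>UNIV. (x $ i) ^ (\<alpha> $ i)))"

text \<open>
  The derivative of the monomial with exponent \<open>\<beta>\<close> with respect to the multi-index \<open>\<alpha>\<close> is the
  product of the falling factorials of length \<open>\<alpha>\<^sub>i\<close> of \<open>\<beta>\<^sub>i\<close>, times the monomial with exponent
  \<open>\<beta> - \<alpha>\<close>.  Subtraction on \<^typ>\<open>nat\<close> truncates, so the scalar has a factor 0 (at \<open>j = \<beta>\<^sub>i\<close>)
  unless \<open>\<alpha> \<le> \<beta>\<close> in all components.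
\<close>

definition mi_ffact :: "nat ^ 'n \<Rightarrow> nat ^ 'n \<Rightarrow> nat" where
  "mi_ffact \<beta> \<alpha> = (\<Prod>i\<in>UNIV. \<Prod>j<\<alpha> $ i. \<beta> $ i - j)"

definition mi_pderiv :: "nat ^ 'n \<Rightarrow> 'n::finite rpoly \<Rightarrow> 'n rpoly" where
  "mi_pderiv \<alpha> f =
     (\<Sum>\<beta>\<in>Poly_Mapping.keys f.
        Poly_Mapping.single (\<beta> - \<alpha>) (Poly_Mapping.lookup f \<beta> * real (mi_ffact \<beta> \<alpha>)))"

lemma lookup_mi_pderiv:
  "Poly_Mapping.lookup (mi_pderiv \<alpha> f) \<gamma> =
     Poly_Mapping.lookup f (\<gamma> + \<alpha>) * real (mi_ffact (\<gamma> + \<alpha>) \<alpha>)"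
proof -
  have zero: "mi_ffact \<beta> \<alpha> = 0" if eq: "\<beta> - \<alpha> = \<gamma>" and neq: "\<beta> \<noteq> \<gamma> + \<alpha>" for \<beta>
  proof -
    obtain i where "\<beta> $ i \<noteq> (\<gamma> + \<alpha>) $ i" using neq by (auto simp: vec_eq_iff)
    then have "\<beta> $ i < \<alpha> $ i" using eq by auto
    then have "(\<Prod>j<\<alpha> $ i. \<beta> $ i - j) = 0" by auto
    then show ?thesis unfolding mi_ffact_def by auto
  qed
  have "Poly_Mapping.lookup (mi_pderiv \<alpha> f) \<gamma> =
      (\<Sum>\<beta>\<in>Poly_Mapping.keys f. (Poly_Mapping.lookup f \<beta> * real (mi_ffact \<beta> \<alpha>) when \<beta> - \<alpha> = \<gamma>))"
    unfolding mi_pderiv_def by (simp add: lookup_sum lookup_single)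
  also have "\<dots> = (\<Sum>\<beta>\<in>Poly_Mapping.keys f.
      if \<beta> = \<gamma> + \<alpha> then Poly_Mapping.lookup f \<beta> * real (mi_ffact \<beta> \<alpha>) else 0)"
    by (rule sum.cong) (auto simp: when_def zero vec_eq_iff)
  also have "\<dots> = Poly_Mapping.lookup f (\<gamma> + \<alpha>) * real (mi_ffact (\<gamma> + \<alpha>) \<alpha>)"
    by (simp add: sum.delta in_keys_iff)
  finally show ?thesis .
qed

lemma mi_pderiv_0: "mi_pderiv 0 f = f"
  by (rule poly_mapping_eqI) (simp add: lookup_mi_pderiv mi_ffact_def)

lemma mi_ffact_add: "mi_ffact \<gamma> (\<alpha> + \<beta>) = mi_ffact \<gamma> \<beta> * mi_ffact (\<gamma> - \<beta>) \<alpha>"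
proof -
  have "(\<Prod>j<a + b. c - j) = (\<Prod>j<b. c - j) * (\<Prod>j<a. c - b - j)" for a b c :: nat
    by (induction a) (auto simp: algebra_simps)
  then show ?thesis unfolding mi_ffact_def by (simp add: prod.distrib)
qed

lemma mi_pderiv_add:
  fixes f :: "'n::finite rpoly"
  shows "mi_pderiv (\<alpha> + \<beta>) f = mi_pderiv \<alpha> (mi_pderiv \<beta> f)"
proof (rule poly_mapping_eqI)
  fix \<gamma> :: "nat ^ 'n"
  have "\<gamma> + (\<alpha> + \<beta>) - \<beta> = \<gamma> + \<alpha>" by (simp add: vec_eq_iff)
  then show "Poly_Mapping.lookup (mi_pderiv (\<alpha> + \<beta>) f) \<gamma> =
      Poly_Mapping.lookup (mi_pderiv \<alpha> (mi_pderiv \<beta> f)) \<gamma>"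
    by (simp add: lookup_mi_pderiv mi_ffact_add add.assoc)
qed

lemma eval_rpoly_sum_single:
  assumes "finite A"
  shows "eval_rpoly (\<Sum>a\<in>A. Poly_Mapping.single (e a) (c a)) x =
           (\<Sum>a\<in>A. of_real (c a) * (\<Prod>i\<in>UNIV. (x $ i) ^ (e a $ i)))"
proof -
  have sup: "eval_rpoly g x =
      (\<Sum>\<alpha>\<in>S. of_real (Poly_Mapping.lookup g \<alpha>) * (\<Prod>i\<in>UNIV. (x $ i) ^ (\<alpha> $ i)))"
    if "finite S" "Poly_Mapping.keys g \<subseteq> S" for g S
    unfolding eval_rpoly_def by (rule sum.mono_neutral_left) (use that in \<open>auto simp: in_keys_iff\<close>)
  have add: "eval_rpoly (g + h) x = eval_rpoly g x + eval_rpoly h x" for g h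
  proof -
    let ?S = "Poly_Mapping.keys g \<union> Poly_Mapping.keys h"
    have "Poly_Mapping.keys (g + h) \<subseteq> ?S" by (rule keys_add)
    then show ?thesis
      by (subst (1 2 3) sup[of ?S]) (auto simp: lookup_add algebra_simps sum.distrib)
  qed
  have single: "eval_rpoly (Poly_Mapping.single \<alpha> b) x = of_real b * (\<Prod>i\<in>UNIV. (x $ i) ^ (\<alpha> $ i))"
    for \<alpha> b
    by (simp add: eval_rpoly_def)
  have zero: "eval_rpoly 0 x = 0" by (simp add: eval_rpoly_def)
  show ?thesis using assms
    by (induction A rule: finite_induct) (auto simp: zero add single)
qed

lemma has_derivative_mi_pderiv_axis:
  fixes f :: "'n::finite rpoly" and x :: "real ^ 'n"
  shows "((\<lambda>t. eval_rpoly f (x + axis i t)) has_field_derivative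
           eval_rpoly (mi_pderiv (axis i 1) f) x) (at 0)"
proof -
  have ff: "mi_ffact \<beta> (axis i 1) = \<beta> $ i" for \<beta> :: "nat ^ 'n"
  proof -
    have "mi_ffact \<beta> (axis i 1) = (\<Prod>k\<in>UNIV. if k = i then \<beta> $ i else 1)"
      unfolding mi_ffact_def by (rule prod.cong) (auto simp: axis_def)
    then show ?thesis by simp
  qed
  have split: "(\<Prod>k\<in>UNIV. g k) = g i * (\<Prod>k\<in>UNIV - {i}. g k)" for g :: "'n \<Rightarrow> real"
    by (rule prod.remove) auto
  have rest: "(\<Prod>k\<in>UNIV - {i}. ((x + axis i t) $ k) ^ (\<beta> $ k)) = (\<Prod>k\<in>UNIV - {i}. (x $ k) ^ (\<beta> $ k))"
    for \<beta> t by (rule prod.cong) (auto simp: axis_def)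
  have rest': "(\<Prod>k\<in>UNIV - {i}. (x $ k) ^ ((\<beta> - axis i 1) $ k)) = (\<Prod>k\<in>UNIV - {i}. (x $ k) ^ (\<beta> $ k))"
    for \<beta> :: "nat ^ 'n" by (rule prod.cong) (auto simp: axis_def)
  show ?thesis
    unfolding mi_pderiv_def eval_rpoly_sum_single[OF finite_keys]
    unfolding eval_rpoly_def split rest rest' ff
    by (auto intro!: derivative_eq_intros sum.cong simp: axis_def)
qed

section \<open>Complex distance to the zero set\<close>

definition complex_zeros :: "'n::finite rpoly \<Rightarrow> (complex ^ 'n) set" where
  "complex_zeros f = {z. eval_rpoly f z = 0}"

definition complex_point :: "real ^ 'n \<Rightarrow> complex ^ 'n" where
  "complex_point x = (\<chi> i. complex_of_real (x $ i))"

text \<open>The infimum over the empty set in \<^typ>\<open>ereal\<close> is \<open>\<infinity>\<close>.\<close>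

definition dist_complex :: "real ^ 'n \<Rightarrow> 'n::finite rpoly \<Rightarrow> ereal" where
  "dist_complex x f = (INF z\<in>complex_zeros f. ereal (dist (complex_point x) z))"

text \<open>On a nonempty compact set the supremum of the distance function is a maximum.\<close>

lemma SUP_dist_complex_attained:
  fixes f :: "'n::finite rpoly"
  assumes "compact J" "J \<noteq> {}"
  shows "\<exists>x\<in>J. dist_complex x f = (SUP y\<in>J. dist_complex y f)"
proof (cases "complex_zeros f = {}")
  case True
  then show ?thesis using assms by (auto simp: dist_complex_def)
next
  case False
  have eq: "dist_complex x f = ereal (infdist (complex_point x) (complex_zeros f))" for x
  proof -
    have "ereal (INF z\<in>complex_zeros f. dist (complex_point x) z) =
        (INF z\<in>complex_zeros f. ereal (dist (complex_point x) z))"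
      using False by (subst ereal_Inf') (auto simp: image_image)
    then show ?thesis using False by (simp add: dist_complex_def infdist_def)
  qed
  have "continuous_on J (\<lambda>x. infdist (complex_point x) (complex_zeros f))"
    unfolding complex_point_def by (intro continuous_intros)
  then obtain x where x: "x \<in> J"
    "\<And>y. y \<in> J \<Longrightarrow> infdist (complex_point y) (complex_zeros f) \<le> infdist (complex_point x) (complex_zeros f)"
    using continuous_attains_sup[OF assms] by metis
  then have "(SUP y\<in>J. dist_complex y f) = dist_complex x f"
    by (intro antisym SUP_least SUP_upper) (auto simp: eq)
  then show ?thesis using x(1) by metis
qed

section \<open>Cubes and the standard centered form\<close>

definition is_cube :: "(real ^ 'n) set \<Rightarrow> bool" where
  "is_cube J \<longleftrightarrow> (\<exists>a w. 0 < w \<and> J = cbox a (a + (\<chi> i. w)))"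

definition cube_midpoint :: "(real ^ 'n) set \<Rightarrow> real ^ 'n" where
  "cube_midpoint J = midpoint (interval_lowerbound J) (interval_upperbound J)"

definition cube_width :: "(real ^ 'n) set \<Rightarrow> real" where
  "cube_width J = (THE w. interval_upperbound J - interval_lowerbound J = (\<chi> i. w))"

lemma
  fixes a :: "real ^ 'n"
  assumes "0 < w"
  shows cube_midpoint_cbox: "cube_midpoint (cbox a (a + (\<chi> i. w))) = a + (\<chi> i. w / 2)"
    and cube_width_cbox: "cube_width (cbox a (a + (\<chi> i. w))) = w"
proof -
  have le: "a \<bullet> b \<le> (a + (\<chi> i. w)) \<bullet> b" if "b \<in> Basis" for b
    using that assms by (auto simp: Basis_vec_def inner_axis)
  show "cube_midpoint (cbox a (a + (\<chi> i. w))) = a + (\<chi> i. w / 2)"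
    using le by (simp add: cube_midpoint_def midpoint_def vec_eq_iff algebra_simps)
  show "cube_width (cbox a (a + (\<chi> i. w))) = w"
    using le by (simp add: cube_width_def vec_eq_iff)
qed

definition centered_radius :: "'n::finite rpoly \<Rightarrow> (real ^ 'n) set \<Rightarrow> real" where
  "centered_radius f J =
     (\<Sum>\<alpha> | 1 \<le> mi_degree \<alpha> \<and> mi_degree \<alpha> \<le> total_degree f.
        \<bar>eval_rpoly (mi_pderiv \<alpha> f) (cube_midpoint J)\<bar> / real (mi_fact \<alpha>) *
          (cube_width J / 2) ^ mi_degree \<alpha>)"

lemma finite_mi_degree_le: "finite {\<alpha> :: nat ^ 'n. P \<alpha> \<and> mi_degree \<alpha> \<le> d}"
proof (rule finite_subset)
  show "{\<alpha> :: nat ^ 'n. P \<alpha> \<and> mi_degree \<alpha> \<le> d} \<subseteq> vec_lambda ` (UNIV \<rightarrow>\<^sub>E {..d})"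
  proof
    fix \<alpha> :: "nat ^ 'n" assume "\<alpha> \<in> {\<alpha>. P \<alpha> \<and> mi_degree \<alpha> \<le> d}"
    then have "\<alpha> $ i \<le> d" for i
      using member_le_sum[of i UNIV "\<lambda>i. \<alpha> $ i"] by (auto simp: mi_degree_def)
    then have "vec_nth \<alpha> \<in> UNIV \<rightarrow>\<^sub>E {..d}" by auto
    then show "\<alpha> \<in> vec_lambda ` (UNIV \<rightarrow>\<^sub>E {..d})" by (metis image_eqI vec_nth_inverse)
  qed
qed (intro finite_imageI finite_PiE; simp)

definition centered_form :: "'n::finite rpoly \<Rightarrow> (real ^ 'n) set \<Rightarrow> real set" where
  "centered_form f J =
     (\<lambda>t. eval_rpoly f (cube_midpoint J) + centered_radius f J * t) ` {-1..1}"

definition C_test :: "'n::finite rpoly \<Rightarrow> (real ^ 'n) set \<Rightarrow> bool" where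
  "C_test f J \<longleftrightarrow> 0 \<notin> centered_form f J"

end

theory Submission
  imports Defs "HOL-Computational_Algebra.Fundamental_Theorem_Algebra"
begin

text \<open>
  Let \<open>D > 0\<close> be the degree of \<open>f\<close> (for constant \<open>f\<close> the radius is 0), \<open>m\<close> the midpoint of the cube,
  \<open>w\<close> its width and \<open>L = ln (1 + 2\<^sup>2\<^sup>-\<^sup>2\<^sup>n)\<close>.  The hypothesis at \<open>x\<close> and the triangle inequality bound the distance
  from \<open>m\<close> to the complex zero set below by \<open>r\<close> times the half-diameter \<open>sqrt n * w / 2\<close>, where
  \<open>r = 2\<^sup>n * D / (sqrt n * L)\<close>.  If all \<open>|u\<^sub>i|\<close> equal \<open>w / 2\<close>, the univariate polynomial
  \<open>t \<mapsto> f (m + t u)\<close> therefore has no root with \<open>|t| < r\<close>, so by factorisation its \<open>k\<close>-th coefficient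
  is at most \<open>|f m| * (D choose k) / r\<^sup>k\<close>.  That coefficient is the homogeneous part of degree \<open>k\<close> of the
  Taylor expansion at \<open>u\<close>, and averaging over a torus extracts each of its at most \<open>n\<^sup>k\<close> Taylor
  coefficients with the same bound.  Summing over \<open>k\<close>, the radius of the centered form is at most
  \<open>|f m| * ((1 + n / r)\<^sup>D - 1)\<close>, and \<open>(1 + n / r)\<^sup>D \<le> exp (n * sqrt n * L / 2\<^sup>n) < exp L \<le> 2\<close>.
\<close>

section \<open>Taylor expansion in multi-index notation\<close>

lemma prod_falling_eq_fact_binomial: "(\<Prod>j<k. b - j) = fact k * (b choose k)" for b k :: nat
proof (induction k)
  case (Suc k)
  have "(b - k) * (b choose k) = Suc k * (b choose Suc k)"
    by (metis binomial_absorb_comp diff_Suc_1 mult.commute times_binomial_minus1_eq zero_less_Suc)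
  then show ?case using Suc by (simp add: algebra_simps)
qed simp

text \<open>Dividing a derivative by \<open>mi_fact \<alpha>\<close> thus leaves binomial
  coefficients, which match those of the binomial theorem.\<close>

lemma mi_ffact_eq: "mi_ffact \<beta> \<alpha> = mi_fact \<alpha> * (\<Prod>i\<in>UNIV. \<beta> $ i choose \<alpha> $ i)"
  by (simp add: mi_ffact_def mi_fact_def prod_falling_eq_fact_binomial prod.distrib)

lemma mi_fact_pos: "0 < mi_fact \<alpha>"
  by (simp add: mi_fact_def prod_pos)

text \<open>The binomial theorem in each coordinate, multiplied out. The sum runs over all \<alpha>
  of degree at most \<open>D\<close>, not just \<alpha> \<le> \<beta>, so that its range is the same
  for every monomial of a polynomial and sums can be swapped; the added terms contain a binomial
  coefficient 0.\<close>

lemma prod_add_power_mi: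
  fixes x z :: "'a::comm_ring_1 ^ 'n"
  assumes "mi_degree \<beta> \<le> D"
  shows "(\<Prod>i\<in>UNIV. ((x + z) $ i) ^ (\<beta> $ i)) =
    (\<Sum>\<alpha> | mi_degree \<alpha> \<le> D. of_nat (\<Prod>i\<in>UNIV. \<beta> $ i choose \<alpha> $ i) *
       (\<Prod>i\<in>UNIV. (x $ i) ^ ((\<beta> - \<alpha>) $ i)) * (\<Prod>i\<in>UNIV. (z $ i) ^ (\<alpha> $ i)))"
proof -
  let ?g = "\<lambda>\<alpha>. of_nat (\<Prod>i\<in>UNIV. \<beta> $ i choose \<alpha> $ i) *
       (\<Prod>i\<in>UNIV. (x $ i) ^ ((\<beta> - \<alpha>) $ i)) * (\<Prod>i\<in>UNIV. (z $ i) ^ (\<alpha> $ i)) :: 'a"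
  have "(\<Prod>i\<in>UNIV. ((x + z) $ i) ^ (\<beta> $ i)) =
      (\<Prod>i\<in>UNIV. \<Sum>k\<le>\<beta> $ i. of_nat (\<beta> $ i choose k) * (z $ i) ^ k * (x $ i) ^ (\<beta> $ i - k))"
    by (simp add: add.commute[of "x $ _"] binomial_ring)
  also have "\<dots> = (\<Sum>g\<in>PiE UNIV (\<lambda>i. {..\<beta> $ i}).
      \<Prod>i\<in>UNIV. of_nat (\<beta> $ i choose g i) * (z $ i) ^ g i * (x $ i) ^ (\<beta> $ i - g i))"
    by (rule prod_sum_PiE) auto
  also have "\<dots> = (\<Sum>\<alpha> | \<forall>i. \<alpha> $ i \<le> \<beta> $ i. ?g \<alpha>)"
    by (rule sum.reindex_bij_witness[where i = vec_nth and j = vec_lambda])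
       (auto simp: prod.distrib PiE_def Pi_def algebra_simps)
  also have "\<dots> = (\<Sum>\<alpha> | mi_degree \<alpha> \<le> D. ?g \<alpha>)"
  proof (rule sum.mono_neutral_left)
    show "finite {\<alpha> :: nat ^ 'n. mi_degree \<alpha> \<le> D}"
      using finite_mi_degree_le[of "\<lambda>_. True" D] by simp
    show "{\<alpha>. \<forall>i. \<alpha> $ i \<le> \<beta> $ i} \<subseteq> {\<alpha>. mi_degree \<alpha> \<le> D}"
      using assms by (auto simp: mi_degree_def intro: order_trans[OF sum_mono])
    show "\<forall>\<alpha>\<in>{\<alpha>. mi_degree \<alpha> \<le> D} - {\<alpha>. \<forall>i. \<alpha> $ i \<le> \<beta> $ i}. ?g \<alpha> = 0"
    proof
      fix \<alpha> assume "\<alpha> \<in> {\<alpha>. mi_degree \<alpha> \<le> D} - {\<alpha>. \<forall>i. \<alpha> $ i \<le> \<beta> $ i}"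
      then obtain i where "\<beta> $ i < \<alpha> $ i" by (auto simp: not_le)
      then have "(\<Prod>i\<in>UNIV. \<beta> $ i choose \<alpha> $ i) = 0" by (auto intro!: exI[of _ i])
      then show "?g \<alpha> = 0" by (simp only: of_nat_0 mult_zero_left)
    qed
  qed
  finally show ?thesis .
qed

lemma mi_degree_le_total_degree:
  "\<beta> \<in> Poly_Mapping.keys f \<Longrightarrow> mi_degree \<beta> \<le> total_degree f"
  by (simp add: total_degree_def)

text \<open>Each monomial is expanded by the binomial theorem and the two sums are swapped. The
  general ring type allows complex increments at a real midpoint embedded by
  \<open>complex_point\<close>.\<close>

lemma eval_rpoly_taylor:
  fixes f :: "'n::finite rpoly" and x z :: "'a::{real_algebra_1, comm_ring_1} ^ 'n"
  shows "eval_rpoly f (x + z) = (\<Sum>\<alpha> | mi_degree \<alpha> \<le> total_degree f.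
    of_real (1 / real (mi_fact \<alpha>)) * eval_rpoly (mi_pderiv \<alpha> f) x * (\<Prod>i\<in>UNIV. (z $ i) ^ (\<alpha> $ i)))"
proof -
  let ?A = "{\<alpha> :: nat ^ 'n. mi_degree \<alpha> \<le> total_degree f}"
  let ?c = "Poly_Mapping.lookup f"
  have "eval_rpoly f (x + z) = (\<Sum>\<beta>\<in>Poly_Mapping.keys f. \<Sum>\<alpha>\<in>?A. of_real (?c \<beta>) *
     (of_nat (\<Prod>i\<in>UNIV. \<beta> $ i choose \<alpha> $ i) *
       (\<Prod>i\<in>UNIV. (x $ i) ^ ((\<beta> - \<alpha>) $ i)) * (\<Prod>i\<in>UNIV. (z $ i) ^ (\<alpha> $ i))))"
    unfolding eval_rpoly_def sum_distrib_left[symmetric]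
    by (intro sum.cong refl arg_cong2[of _ _ _ _ "(*)"] prod_add_power_mi mi_degree_le_total_degree)
  also have "\<dots> = (\<Sum>\<alpha>\<in>?A. \<Sum>\<beta>\<in>Poly_Mapping.keys f. of_real (1 / real (mi_fact \<alpha>)) *
      (of_real (?c \<beta> * real (mi_ffact \<beta> \<alpha>)) * (\<Prod>i\<in>UNIV. (x $ i) ^ ((\<beta> - \<alpha>) $ i))) *
      (\<Prod>i\<in>UNIV. (z $ i) ^ (\<alpha> $ i)))"
  proof (subst sum.swap, intro sum.cong refl)
    fix \<alpha> \<beta> :: "nat ^ 'n"
    have coeff: "1 / real (mi_fact \<alpha>) * (?c \<beta> * real (mi_ffact \<beta> \<alpha>)) =
        ?c \<beta> * real (\<Prod>i\<in>UNIV. \<beta> $ i choose \<alpha> $ i)"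
      using mi_fact_pos[of \<alpha>] by (simp add: mi_ffact_eq del: of_nat_prod)
    have "of_real (1 / real (mi_fact \<alpha>)) * of_real (?c \<beta> * real (mi_ffact \<beta> \<alpha>)) =
        of_real (?c \<beta>) * (of_nat (\<Prod>i\<in>UNIV. \<beta> $ i choose \<alpha> $ i) :: 'a)"
      using arg_cong[OF coeff, of "of_real :: real \<Rightarrow> 'a"]
      by (simp only: of_real_mult of_real_of_nat_eq)
    then show "of_real (?c \<beta>) * (of_nat (\<Prod>i\<in>UNIV. \<beta> $ i choose \<alpha> $ i) *
       (\<Prod>i\<in>UNIV. (x $ i) ^ ((\<beta> - \<alpha>) $ i)) * (\<Prod>i\<in>UNIV. (z $ i) ^ (\<alpha> $ i))) =
      of_real (1 / real (mi_fact \<alpha>)) *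
      (of_real (?c \<beta> * real (mi_ffact \<beta> \<alpha>)) * (\<Prod>i\<in>UNIV. (x $ i) ^ ((\<beta> - \<alpha>) $ i))) *
      (\<Prod>i\<in>UNIV. (z $ i) ^ (\<alpha> $ i))"
      by (simp only: mult.assoc[symmetric])
  qed
  also have "\<dots> = (\<Sum>\<alpha>\<in>?A.
    of_real (1 / real (mi_fact \<alpha>)) * eval_rpoly (mi_pderiv \<alpha> f) x * (\<Prod>i\<in>UNIV. (z $ i) ^ (\<alpha> $ i)))"
    unfolding mi_pderiv_def eval_rpoly_sum_single[OF finite_keys]
    by (simp only: sum_distrib_left sum_distrib_right)
  finally show ?thesis .
qed

lemma eval_rpoly_complex_point:
  "eval_rpoly f (complex_point x) = complex_of_real (eval_rpoly f x)"
  by (simp add: eval_rpoly_def complex_point_def)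

section \<open>Coefficients of univariate polynomials without small roots\<close>

text \<open>The extremal case is a multiple of \<open>(1 + t / r) ^ D\<close>. Induction on the
  degree bound splits off a linear factor \<open>t - a\<close> with \<open>norm a\<close> at least
  \<open>r\<close>; the bounds for two neighbouring coefficients of the quotient combine by Pascal's
  rule.\<close>

lemma coeff_le_binomial_of_no_small_roots:
  fixes p :: "complex poly"
  assumes "0 < r" and "degree p \<le> D" and "\<And>t. norm t < r \<Longrightarrow> poly p t \<noteq> 0"
  shows "norm (coeff p k) \<le> norm (coeff p 0) * real (D choose k) / r ^ k"
  using assms(2,3)
proof (induction D arbitrary: p k)
  case 0
  then show ?case using \<open>0 < r\<close> by (cases k) (auto simp: coeff_eq_0)
next
  case (Suc D)
  show ?case
  \<comment> \<open>\<open>Suc D\<close> only bounds the degree, so a constant \<open>p\<close>,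
    with no root to split off, can occur here too.\<close>
  proof (cases "degree p = 0")
    case True
    then show ?thesis using \<open>0 < r\<close> by (cases k) (auto simp: coeff_eq_0)
  next
    case False
    then obtain a where "poly p a = 0"
      using fundamental_theorem_of_algebra by (metis constant_degree)
    then obtain q where q: "p = [:-a, 1:] * q" by (auto simp: poly_eq_0_iff_dvd dvd_def)
    have a: "r \<le> norm a" using Suc.prems(2)[of a] \<open>poly p a = 0\<close> by force
    have "q \<noteq> 0" using q False by auto
    then have "degree p = Suc (degree q)" using degree_mult_eq[of "[:-a, 1:]" q] by (simp add: q del: mult_pCons_left)
    then have IH: "norm (coeff q j) \<le> norm (coeff q 0) * real (D choose j) / r ^ j" for j
      using Suc.prems q by (intro Suc.IH) auto
    show ?thesis
    proof (cases k)
      case (Suc j)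
      have "norm (coeff p k) \<le> norm a * norm (coeff q k) + norm (coeff q j)"
        using norm_triangle_ineq4[of "coeff q j" "a * coeff q k"]
        by (simp add: q Suc coeff_pCons norm_mult)
      \<comment> \<open>Since \<open>norm a / r\<close> is at least 1, the bound for
        \<open>coeff q j\<close> can be raised to the denominator \<open>r ^ k\<close> at the price
        of a factor \<open>norm a\<close>. Both summands then contain
        \<open>norm a * norm (coeff q 0)\<close>, which is \<open>norm (coeff p 0)\<close>.\<close>
      also have "\<dots> \<le> norm a * (norm (coeff q 0) * real (D choose k) / r ^ k) +
          norm a * (norm (coeff q 0) * real (D choose j) / r ^ k)"
      proof (intro add_mono mult_left_mono IH order_trans[OF IH[of j]])
        have "r * (norm (coeff q 0) * real (D choose j) / r ^ k) \<le>
            norm a * (norm (coeff q 0) * real (D choose j) / r ^ k)"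
          using a \<open>0 < r\<close> by (intro mult_right_mono) auto
        then show "norm (coeff q 0) * real (D choose j) / r ^ j \<le>
            norm a * (norm (coeff q 0) * real (D choose j) / r ^ k)"
          using \<open>0 < r\<close> by (simp add: Suc)
      qed auto
      also have "\<dots> = norm (coeff p 0) * real (Suc D choose k) / r ^ k"
        by (simp add: q Suc norm_mult add_divide_distrib algebra_simps)
      finally show ?thesis .
    qed simp
  qed
qed

section \<open>Coefficient extraction on a torus\<close>

text \<open>A geometric sum with ratio \<open>\<zeta> ^ a * inverse (\<zeta> ^ b)\<close>, an
  \<open>N\<close>-th root of unity that is 1 only for \<open>a = b\<close>, because both exponents
  lie below \<open>N\<close>.\<close>

lemma sum_roots_unity_orthogonal:
  fixes a b N :: nat
  assumes "a < N" and "b < N"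
  defines "\<zeta> \<equiv> exp (2 * of_real pi * \<i> / of_nat N)"
  shows "(\<Sum>j<N. (\<zeta> ^ j) ^ a * inverse ((\<zeta> ^ j) ^ b)) = (if a = b then of_nat N else 0)"
proof -
  have pow: "\<zeta> ^ k = exp (2 * of_real pi * \<i> * of_nat k / of_nat N)" for k
    unfolding \<zeta>_def exp_of_nat_mult[symmetric] by (simp add: mult_ac)
  have N: "1 \<le> N" using assms by simp
  have "\<zeta> ^ N = 1" using N complex_root_unity_eq_1[of N N] by (simp add: pow)
  have nz: "\<zeta> \<noteq> 0" by (simp add: \<zeta>_def)
  define \<eta> where "\<eta> = \<zeta> ^ a * inverse (\<zeta> ^ b)"
  have "(\<zeta> ^ j) ^ a * inverse ((\<zeta> ^ j) ^ b) = \<eta> ^ j" for j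
    by (simp add: \<eta>_def power_mult_distrib power_inverse flip: power_mult)
       (simp add: mult.commute)
  then have eq: "(\<Sum>j<N. (\<zeta> ^ j) ^ a * inverse ((\<zeta> ^ j) ^ b)) = (\<Sum>j<N. \<eta> ^ j)" by simp
  show ?thesis
  proof (cases "a = b")
    case True
    then have "\<eta> = 1" using nz by (simp add: \<eta>_def)
    then show ?thesis unfolding eq using True by simp
  next
    case False
    have "\<eta> ^ N = (\<zeta> ^ N) ^ a * inverse ((\<zeta> ^ N) ^ b)"
      by (simp add: \<eta>_def power_mult_distrib power_inverse flip: power_mult)
         (simp add: mult.commute)
    then have 1: "\<eta> ^ N = 1" using \<open>\<zeta> ^ N = 1\<close> by simp
    have "\<zeta> ^ a \<noteq> \<zeta> ^ b"
      using complex_root_unity_eq[OF N, of a b] False assms(1,2)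
      by (simp only: pow) (simp add: cong_def)
    then have "\<eta> \<noteq> 1" using nz by (simp add: \<eta>_def field_simps)
    then have "(\<Sum>j<N. \<eta> ^ j) = 0" using 1 by (simp add: geometric_sum)
    then show ?thesis using False eq by simp
  qed
qed

text \<open>Cauchy's estimate in several variables: averaging against the inverse of the monomial
  with exponent \<beta> kills all other terms, and the inverse monomial has norm 1 at roots of
  unity.\<close>

lemma torus_coeff_bound:
  fixes c :: "nat ^ 'n \<Rightarrow> complex"
  assumes "finite S" and "\<beta> \<in> S" and "0 \<le> \<rho>"
    and bound: "\<And>u :: complex ^ 'n. (\<And>i. norm (u $ i) = \<rho>) \<Longrightarrow>
      norm (\<Sum>\<alpha>\<in>S. c \<alpha> * (\<Prod>i\<in>UNIV. (u $ i) ^ (\<alpha> $ i))) \<le> M"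
  shows "norm (c \<beta>) * \<rho> ^ mi_degree \<beta> \<le> M"
proof -
  \<comment> \<open>With \<open>N\<close> above every exponent in \<open>S\<close>, distinct
    exponents stay distinct modulo \<open>N\<close>, as orthogonality requires.\<close>
  obtain N where N: "\<And>\<alpha> i. \<alpha> \<in> S \<Longrightarrow> \<alpha> $ i < N"
  proof
    fix \<alpha> i assume "\<alpha> \<in> S"
    have "\<alpha> $ i \<le> mi_degree \<alpha>" by (simp add: mi_degree_def member_le_sum)
    also have "\<dots> < Suc (\<Sum>\<alpha>\<in>S. mi_degree \<alpha>)"
      using \<open>\<alpha> \<in> S\<close> assms(1) by (simp add: less_Suc_eq_le member_le_sum)
    finally show "\<alpha> $ i < Suc (\<Sum>\<alpha>\<in>S. mi_degree \<alpha>)" .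
  qed
  define \<zeta> where "\<zeta> = exp (2 * of_real pi * \<i> / of_nat N)"
  have norm_\<zeta>: "norm \<zeta> = 1" by (simp add: \<zeta>_def norm_exp_eq_Re)
  define G where "G = (UNIV :: 'n set) \<rightarrow>\<^sub>E {..<N}"
  \<comment> \<open>The integral over the torus is replaced by the average over vectors of \<open>N\<close>-th roots of unity.\<close>
  define u :: "('n \<Rightarrow> nat) \<Rightarrow> complex ^ 'n" where "u g = (\<chi> i. of_real \<rho> * \<zeta> ^ g i)" for g
  define F where "F v = (\<Sum>\<alpha>\<in>S. c \<alpha> * (\<Prod>i\<in>UNIV. (v $ i) ^ (\<alpha> $ i)))" for v
  have "(\<Sum>g\<in>G. F (u g) * (\<Prod>i\<in>UNIV. inverse ((\<zeta> ^ g i) ^ (\<beta> $ i)))) =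
      (\<Sum>g\<in>G. \<Sum>\<alpha>\<in>S. c \<alpha> * of_real \<rho> ^ mi_degree \<alpha> *
        (\<Prod>i\<in>UNIV. (\<zeta> ^ g i) ^ (\<alpha> $ i) * inverse ((\<zeta> ^ g i) ^ (\<beta> $ i))))"
    by (simp add: F_def u_def sum_distrib_right power_mult_distrib prod.distrib mi_degree_def power_sum
        mult.assoc del: prod_inversef)
  also have "\<dots> = (\<Sum>\<alpha>\<in>S. c \<alpha> * of_real \<rho> ^ mi_degree \<alpha> *
      (\<Sum>g\<in>G. \<Prod>i\<in>UNIV. (\<zeta> ^ g i) ^ (\<alpha> $ i) * inverse ((\<zeta> ^ g i) ^ (\<beta> $ i))))"
    by (subst sum.swap) (simp only: sum_distrib_left)
  also have "\<dots> = (\<Sum>\<alpha>\<in>S. c \<alpha> * of_real \<rho> ^ mi_degree \<alpha> *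
      (\<Prod>i\<in>UNIV. if \<alpha> $ i = \<beta> $ i then of_nat N else 0))"
  proof (intro sum.cong refl arg_cong2[of _ _ _ _ "(*)"])
    fix \<alpha> assume "\<alpha> \<in> S"
    have "(\<Sum>g\<in>G. \<Prod>i\<in>UNIV. (\<zeta> ^ g i) ^ (\<alpha> $ i) * inverse ((\<zeta> ^ g i) ^ (\<beta> $ i))) =
        (\<Prod>i\<in>UNIV. \<Sum>j<N. (\<zeta> ^ j) ^ (\<alpha> $ i) * inverse ((\<zeta> ^ j) ^ (\<beta> $ i)))"
      unfolding G_def by (rule prod_sum_PiE[symmetric]) auto
    also have "\<dots> = (\<Prod>i\<in>UNIV. if \<alpha> $ i = \<beta> $ i then of_nat N else 0)"
      unfolding \<zeta>_def using N \<open>\<alpha> \<in> S\<close> \<open>\<beta> \<in> S\<close>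
      by (intro prod.cong refl sum_roots_unity_orthogonal) auto
    finally show "(\<Sum>g\<in>G. \<Prod>i\<in>UNIV. (\<zeta> ^ g i) ^ (\<alpha> $ i) * inverse ((\<zeta> ^ g i) ^ (\<beta> $ i))) =
      (\<Prod>i\<in>UNIV. if \<alpha> $ i = \<beta> $ i then of_nat N else 0)" .
  qed
  also have "\<dots> = (\<Sum>\<alpha>\<in>S. if \<alpha> = \<beta> then c \<beta> * of_real \<rho> ^ mi_degree \<beta> * of_nat N ^ CARD('n) else 0)"
  proof (intro sum.cong refl)
    fix \<alpha>
    show "c \<alpha> * of_real \<rho> ^ mi_degree \<alpha> * (\<Prod>i\<in>UNIV. if \<alpha> $ i = \<beta> $ i then of_nat N else 0) =
      (if \<alpha> = \<beta> then c \<beta> * of_real \<rho> ^ mi_degree \<beta> * of_nat N ^ CARD('n) else 0)"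
    proof (cases "\<alpha> = \<beta>")
      case False
      then obtain i where "\<alpha> $ i \<noteq> \<beta> $ i" by (auto simp: vec_eq_iff)
      then have "(\<Prod>i\<in>UNIV. if \<alpha> $ i = \<beta> $ i then of_nat N else 0 :: complex) = 0"
        by (intro prod_zero) auto
      then show ?thesis using False by simp
    qed simp
  qed
  also have "\<dots> = c \<beta> * of_real \<rho> ^ mi_degree \<beta> * of_nat N ^ CARD('n)"
    using assms(1,2) by simp
  finally have avg: "(\<Sum>g\<in>G. F (u g) * (\<Prod>i\<in>UNIV. inverse ((\<zeta> ^ g i) ^ (\<beta> $ i)))) =
      c \<beta> * of_real \<rho> ^ mi_degree \<beta> * of_nat N ^ CARD('n)" .
  have card_G: "card G = N ^ CARD('n)" by (simp add: G_def card_PiE)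
  have "norm (c \<beta>) * \<rho> ^ mi_degree \<beta> * real N ^ CARD('n) =
      norm (\<Sum>g\<in>G. F (u g) * (\<Prod>i\<in>UNIV. inverse ((\<zeta> ^ g i) ^ (\<beta> $ i))))"
    using \<open>0 \<le> \<rho>\<close> by (simp only: avg norm_mult norm_power) simp
  also have "\<dots> \<le> (\<Sum>g\<in>G. M)"
  proof (rule sum_norm_le)
    fix g
    have "norm (F (u g)) \<le> M"
      unfolding F_def using \<open>0 \<le> \<rho>\<close> norm_\<zeta>
      by (intro bound) (simp add: u_def norm_mult norm_power)
    then show "norm (F (u g) * (\<Prod>i\<in>UNIV. inverse ((\<zeta> ^ g i) ^ (\<beta> $ i)))) \<le> M"
      by (simp add: norm_mult norm_power norm_inverse norm_\<zeta> prod_norm[symmetric] del: prod_inversef)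
  qed
  also have "\<dots> = M * real N ^ CARD('n)" by (simp add: card_G)
  finally have "norm (c \<beta>) * \<rho> ^ mi_degree \<beta> * real N ^ CARD('n) \<le> M * real N ^ CARD('n)" .
  moreover have "0 < real N ^ CARD('n)" 
    using N[OF \<open>\<beta> \<in> S\<close>, of undefined] by (intro zero_less_power) linarith
  ultimately show ?thesis by (simp only: mult_le_cancel_right_pos)
qed

section \<open>Summing the coefficient bounds over all degrees\<close>

text \<open>Every multi-index of degree \<open>k + 1\<close> is one of degree \<open>k\<close> plus
  a unit vector, for which there are \<open>CARD('n)\<close> choices. The overcount is harmless and
  yields powers that fit the binomial sum.\<close>

lemma card_mi_degree_le: "card {\<alpha> :: nat ^ 'n. mi_degree \<alpha> = k} \<le> CARD('n) ^ k"
proof (induction k)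
  case 0
  have "{\<alpha> :: nat ^ 'n. mi_degree \<alpha> = 0} = {0}" by (auto simp: mi_degree_def vec_eq_iff)
  then show ?case by simp
next
  case (Suc k)
  let ?A = "\<lambda>k. {\<alpha> :: nat ^ 'n. mi_degree \<alpha> = k}"
  have fin: "finite (?A k)" for k
    by (rule finite_subset[OF _ finite_mi_degree_le[of "\<lambda>_. True" k]]) auto
  have "?A (Suc k) \<subseteq> (\<Union>i\<in>UNIV. (\<lambda>\<alpha>. \<alpha> + axis i 1) ` ?A k)"
  proof
    fix \<alpha> assume \<alpha>: "\<alpha> \<in> ?A (Suc k)"
    have "\<exists>i. 0 < \<alpha> $ i"
    proof (rule ccontr)
      assume "\<nexists>i. 0 < \<alpha> $ i"
      then show False using \<alpha> by (simp add: mi_degree_def)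
    qed
    then obtain i where i: "0 < \<alpha> $ i" by blast
    define \<beta> where "\<beta> = \<alpha> - axis i 1"
    have "\<alpha> = \<beta> + axis i 1" using i by (auto simp: \<beta>_def vec_eq_iff axis_def)
    moreover have "mi_degree (\<beta> + axis i 1) = Suc (mi_degree \<beta>)"
      by (simp add: mi_degree_def sum.distrib axis_def)
    ultimately show "\<alpha> \<in> (\<Union>i\<in>UNIV. (\<lambda>\<alpha>. \<alpha> + axis i 1) ` ?A k)" using \<alpha> by auto
  qed
  then have "card (?A (Suc k)) \<le> card (\<Union>i\<in>UNIV. (\<lambda>\<alpha>. \<alpha> + axis i 1) ` ?A k)"
    using fin by (intro card_mono) auto
  also have "\<dots> \<le> (\<Sum>i\<in>(UNIV :: 'n set). card ((\<lambda>\<alpha>. \<alpha> + axis i 1) ` ?A k))"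
    by (rule card_UN_le) simp
  also have "\<dots> \<le> (\<Sum>i\<in>(UNIV :: 'n set). CARD('n) ^ k)"
    by (intro sum_mono order_trans[OF card_image_le[OF fin] Suc])
  finally show ?case by simp
qed

text \<open>The family \<open>c\<close> stands for the Taylor coefficients at the midpoint.
  Zero-freeness on the complex lines through torus vectors bounds each homogeneous part, hence each
  coefficient, and the binomial theorem sums the bounds.\<close>

lemma sum_coeffs_le_of_no_zeros:
  fixes c :: "nat ^ 'n \<Rightarrow> complex"
  assumes "0 < \<rho>" and "0 < r"
    and nz: "\<And>(u :: complex ^ 'n) t. (\<And>i. norm (u $ i) = \<rho>) \<Longrightarrow> norm t < r \<Longrightarrow>
      (\<Sum>\<alpha> | mi_degree \<alpha> \<le> D. c \<alpha> * (\<Prod>i\<in>UNIV. (t * u $ i) ^ (\<alpha> $ i))) \<noteq> 0"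
  shows "(\<Sum>\<alpha> | 1 \<le> mi_degree \<alpha> \<and> mi_degree \<alpha> \<le> D. norm (c \<alpha>) * \<rho> ^ mi_degree \<alpha>) \<le>
    norm (c 0) * ((1 + real CARD('n) / r) ^ D - 1)"
proof -
  let ?A = "\<lambda>k. {\<alpha> :: nat ^ 'n. mi_degree \<alpha> = k}"
  let ?n = "real CARD('n)"
  have fin: "finite {\<alpha> :: nat ^ 'n. mi_degree \<alpha> \<le> D}"
    using finite_mi_degree_le[of "\<lambda>_. True" D] by simp
  have finA: "finite (?A k)" for k
    by (rule finite_subset[OF _ finite_mi_degree_le[of "\<lambda>_. True" k]]) auto
  have A0: "?A 0 = {0}" by (auto simp: mi_degree_def vec_eq_iff)
  have hom: "norm (\<Sum>\<alpha>\<in>?A k. c \<alpha> * (\<Prod>i\<in>UNIV. (u $ i) ^ (\<alpha> $ i))) \<le>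
      norm (c 0) * real (D choose k) / r ^ k"
    if u: "\<And>i. norm (u $ i) = \<rho>" and k: "k \<le> D" for u k
  proof -
    \<comment> \<open>The restriction to the line through \<open>u\<close>, as a polynomial in
      \<open>t\<close>: its coefficient of degree \<open>j\<close> is the homogeneous part of degree
      \<open>j\<close> at \<open>u\<close>.\<close>
    define p where "p = (\<Sum>\<alpha> | mi_degree \<alpha> \<le> D.
      monom (c \<alpha> * (\<Prod>i\<in>UNIV. (u $ i) ^ (\<alpha> $ i))) (mi_degree \<alpha>))"
    have coeff: "coeff p j = (\<Sum>\<alpha>\<in>?A j. c \<alpha> * (\<Prod>i\<in>UNIV. (u $ i) ^ (\<alpha> $ i)))" if "j \<le> D" for j
      unfolding p_def coeff_sum coeff_monom
      by (rule sum.mono_neutral_cong_right) (use fin that in auto)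
    have "degree p \<le> D"
      unfolding p_def by (intro degree_sum_le fin order_trans[OF degree_monom_le]) auto
    moreover have "poly p t \<noteq> 0" if "norm t < r" for t
      using nz[OF u that]
      by (simp add: p_def poly_sum poly_monom power_mult_distrib prod.distrib mi_degree_def power_sum mult_ac)
    ultimately have "norm (coeff p k) \<le> norm (coeff p 0) * real (D choose k) / r ^ k"
      using \<open>0 < r\<close> by (intro coeff_le_binomial_of_no_small_roots) auto
    then show ?thesis using k by (simp add: coeff A0)
  qed
  have "(\<Sum>\<alpha> | 1 \<le> mi_degree \<alpha> \<and> mi_degree \<alpha> \<le> D. norm (c \<alpha>) * \<rho> ^ mi_degree \<alpha>) =
      (\<Sum>k=1..D. \<Sum>\<alpha>\<in>?A k. norm (c \<alpha>) * \<rho> ^ mi_degree \<alpha>)"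
  proof -
    let ?S = "{\<alpha> :: nat ^ 'n. 1 \<le> mi_degree \<alpha> \<and> mi_degree \<alpha> \<le> D}"
    have "{\<alpha> \<in> ?S. mi_degree \<alpha> = k} = ?A k" if "k \<in> {1..D}" for k using that by auto
    moreover have "(\<Sum>k=1..D. \<Sum>\<alpha> | \<alpha> \<in> ?S \<and> mi_degree \<alpha> = k. norm (c \<alpha>) * \<rho> ^ mi_degree \<alpha>) =
        (\<Sum>\<alpha>\<in>?S. norm (c \<alpha>) * \<rho> ^ mi_degree \<alpha>)"
      by (rule sum.group) (use finite_mi_degree_le in auto)
    ultimately show ?thesis by simp
  qed
  also have "\<dots> \<le> (\<Sum>k=1..D. ?n ^ k * (norm (c 0) * real (D choose k) / r ^ k))"
  proof (rule sum_mono)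
    fix k assume k: "k \<in> {1..D}"
    have "(\<Sum>\<alpha>\<in>?A k. norm (c \<alpha>) * \<rho> ^ mi_degree \<alpha>) \<le>
        (\<Sum>\<alpha>\<in>?A k. norm (c 0) * real (D choose k) / r ^ k)"
      using k \<open>0 < \<rho>\<close> by (intro sum_mono torus_coeff_bound[OF finA _ _ hom]) auto
    also have "\<dots> = real (card (?A k)) * (norm (c 0) * real (D choose k) / r ^ k)" by simp
    also have "\<dots> \<le> ?n ^ k * (norm (c 0) * real (D choose k) / r ^ k)"
      using card_mi_degree_le[where 'n = 'n, of k] \<open>0 < r\<close>
      by (intro mult_right_mono) (auto simp flip: of_nat_power)
    finally show "(\<Sum>\<alpha>\<in>?A k. norm (c \<alpha>) * \<rho> ^ mi_degree \<alpha>) \<le>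
        ?n ^ k * (norm (c 0) * real (D choose k) / r ^ k)" .
  qed
  also have "\<dots> = norm (c 0) * (\<Sum>k=1..D. real (D choose k) * (?n / r) ^ k)"
    by (simp add: sum_distrib_left power_divide mult_ac)
  also have "(\<Sum>k=1..D. real (D choose k) * (?n / r) ^ k) = (1 + ?n / r) ^ D - 1"
  proof -
    have "(1 + ?n / r) ^ D = (\<Sum>k\<le>D. real (D choose k) * (?n / r) ^ k)"
      using binomial_ring[of "?n / r" 1 D] by (simp add: add.commute)
    also have "{..D} = insert 0 {1..D}" by auto
    finally show ?thesis by simp
  qed
  finally show ?thesis .
qed

section \<open>Comparison of powers\<close>

text \<open>The square of \<open>n * sqrt n < 2 ^ n\<close>, which later makes the exponent
  \<open>n * sqrt n / 2 ^ n * L\<close> smaller than \<open>L\<close>.\<close>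

lemma power3_less_four_power: "0 < n \<Longrightarrow> n ^ 3 < 4 ^ n" for n :: nat
proof (induction n rule: nat_induct_non_zero)
  case (Suc n)
  show ?case
  \<comment> \<open>From 3 on, passing to \<open>Suc n\<close> multiplies the cube by at most 4; the
    two smaller cases are computed.\<close>
  proof (cases "n \<le> 2")
    case True
    then have "n = 1 \<or> n = 2" using Suc by auto
    then show ?thesis by (auto simp: eval_nat_numeral)
  next
    case False
    then have "3 \<le> n" by simp
    then have "3 * n \<le> n * n" and "3 * (n * n) \<le> n * (n * n)" by simp_all
    moreover have "Suc n ^ 3 = n * (n * n) + 3 * (n * n) + 3 * n + 1"
      by (simp add: eval_nat_numeral algebra_simps)
    ultimately have "Suc n ^ 3 \<le> 4 * (n * (n * n))" using \<open>3 \<le> n\<close> by linarith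
    then have "Suc n ^ 3 \<le> 4 * n ^ 3" by (simp add: power3_eq_cube mult.assoc)
    then show ?thesis using Suc by simp
  qed
qed simp

lemma mult_sqrt_less_two_power: "0 < n \<Longrightarrow> real n * sqrt (real n) < 2 ^ n"
proof (rule power2_less_imp_less)
  assume "0 < n"
  have "(real n * sqrt (real n))\<^sup>2 = real (n ^ 3)"
    by (simp add: power_mult_distrib power3_eq_cube power2_eq_square)
  also have "\<dots> < real (4 ^ n)" using power3_less_four_power[OF \<open>0 < n\<close>] by linarith
  also have "\<dots> = (2 ^ n)\<^sup>2" by (simp flip: power_mult_distrib power_mult add: power2_eq_square)
  finally show "(real n * sqrt (real n))\<^sup>2 < (2 ^ n)\<^sup>2" .
qed simp

section \<open>The centered radius under a zero-free ball\<close>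

lemma C_testI:
  assumes "0 \<le> centered_radius f J"
    and "centered_radius f J < \<bar>eval_rpoly f (cube_midpoint J)\<bar>"
  shows "C_test f J"
  unfolding C_test_def centered_form_def
proof
  assume "0 \<in> (\<lambda>t. eval_rpoly f (cube_midpoint J) + centered_radius f J * t) ` {-1..1}"
  then obtain t :: real where t: "\<bar>t\<bar> \<le> 1"
    and eq: "eval_rpoly f (cube_midpoint J) = - (centered_radius f J * t)"
    by (force simp: eq_neg_iff_add_eq_0 abs_le_iff)
  have "\<bar>eval_rpoly f (cube_midpoint J)\<bar> = centered_radius f J * \<bar>t\<bar>"
    using assms(1) by (simp add: eq abs_mult)
  also have "\<dots> \<le> centered_radius f J * 1" using assms(1) t by (rule mult_left_mono[rotated])
  finally show False using assms(2) by simp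
qed

lemma eval_rpoly_total_degree_0:
  fixes x y :: "'a::{real_algebra_1, comm_ring_1} ^ 'n"
  assumes "total_degree f = 0"
  shows "eval_rpoly f x = eval_rpoly f y"
  unfolding eval_rpoly_def
proof (intro sum.cong refl)
  fix \<alpha> assume "\<alpha> \<in> Poly_Mapping.keys f"
  then have "\<alpha> = 0" using mi_degree_le_total_degree[of \<alpha> f] assms
    by (simp add: mi_degree_def vec_eq_iff)
  then show "of_real (Poly_Mapping.lookup f \<alpha>) * (\<Prod>i\<in>UNIV. (x $ i) ^ (\<alpha> $ i)) =
    of_real (Poly_Mapping.lookup f \<alpha>) * (\<Prod>i\<in>UNIV. (y $ i) ^ (\<alpha> $ i))" by simp
qed

lemma norm_complex_point: "norm (complex_point x) = norm x"
  by (simp add: complex_point_def norm_vec_def)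

lemma norm_const_vec:
  fixes u :: "'a::real_normed_vector ^ 'n"
  assumes "\<And>i. norm (u $ i) = c" and "0 \<le> c"
  shows "norm u = sqrt (real CARD('n)) * c"
  using assms by (simp add: norm_vec_def L2_set_def real_sqrt_mult)

text \<open>Here \<open>r\<close> is measured in half-diameters of the cube: a vector with all
  entries of norm \<open>cube_width J / 2\<close> has exactly that length, so its multiples by
  \<open>t\<close> with \<open>norm t < r\<close> stay inside the zero-free ball around the
  midpoint.\<close>

lemma centered_radius_less:
  fixes f :: "'n::finite rpoly" and J :: "(real ^ 'n) set"
  assumes w: "0 < cube_width J" and r: "0 < r"
    and zeros: "\<And>z. z \<in> complex_zeros f \<Longrightarrow>
      r * (sqrt (real CARD('n)) * (cube_width J / 2)) \<le> dist z (complex_point (cube_midpoint J))"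
    and small: "(1 + real CARD('n) / r) ^ total_degree f < 2"
  shows "centered_radius f J < \<bar>eval_rpoly f (cube_midpoint J)\<bar>"
proof -
  let ?m = "cube_midpoint J" and ?\<rho> = "cube_width J / 2" and ?D = "total_degree f"
  define c where "c \<alpha> = complex_of_real (1 / real (mi_fact \<alpha>)) *
    eval_rpoly (mi_pderiv \<alpha> f) (complex_point ?m)" for \<alpha>
  have norm_c: "norm (c \<alpha>) = \<bar>eval_rpoly (mi_pderiv \<alpha> f) ?m\<bar> / real (mi_fact \<alpha>)" for \<alpha>
    by (simp add: c_def eval_rpoly_complex_point norm_mult norm_divide)
  have c0: "norm (c 0) = \<bar>eval_rpoly f ?m\<bar>"
    by (simp add: norm_c mi_pderiv_0) (simp add: mi_fact_def)
  have pos: "0 < sqrt (real CARD('n)) * ?\<rho>" using w by simp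
  have nonzero: "(\<Sum>\<alpha> | mi_degree \<alpha> \<le> ?D. c \<alpha> * (\<Prod>i\<in>UNIV. (t * u $ i) ^ (\<alpha> $ i))) \<noteq> 0"
    if u: "\<And>i. norm (u $ i) = ?\<rho>" and t: "norm t < r" for u :: "complex ^ 'n" and t
  proof
    assume 0: "(\<Sum>\<alpha> | mi_degree \<alpha> \<le> ?D. c \<alpha> * (\<Prod>i\<in>UNIV. (t * u $ i) ^ (\<alpha> $ i))) = 0"
    define v where "v = (\<chi> i. t * u $ i)"
    have "eval_rpoly f (complex_point ?m + v) = 0"
      using 0 by (simp add: eval_rpoly_taylor c_def v_def)
    then have "r * (sqrt (real CARD('n)) * ?\<rho>) \<le> norm v"
      using zeros[of "complex_point ?m + v"] by (simp add: complex_zeros_def dist_norm)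
    also have "norm v = sqrt (real CARD('n)) * (norm t * ?\<rho>)"
      using u w by (intro norm_const_vec) (auto simp: v_def norm_mult)
    also have "\<dots> < r * (sqrt (real CARD('n)) * ?\<rho>)"
      using mult_strict_right_mono[OF t pos] by (simp add: mult_ac)
    finally show False by simp
  qed
  \<comment> \<open>A zero at the midpoint would have distance 0 from it. Nonvanishing makes the
    final estimate strict.\<close>
  have "norm (c 0) \<noteq> 0"
  proof
    assume "norm (c 0) = 0"
    then have "complex_point ?m \<in> complex_zeros f"
      using c0 by (simp add: complex_zeros_def eval_rpoly_complex_point)
    then show False using zeros mult_pos_pos[OF r pos] by fastforce
  qed
  then have "0 < norm (c 0)" by simp
  have "centered_radius f J \<le> norm (c 0) * ((1 + real CARD('n) / r) ^ ?D - 1)"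
    using sum_coeffs_le_of_no_zeros[where c = c and \<rho> = ?\<rho>, OF _ r nonzero] w
    by (simp add: centered_radius_def norm_c)
  also have "\<dots> < norm (c 0) * 1"
    using small \<open>0 < norm (c 0)\<close> by (intro mult_strict_left_mono) auto
  finally show ?thesis by (simp add: c0)
qed

section \<open>The constants and the distance hypothesis\<close>

text \<open>By \<open>1 + q \<le> exp q\<close> the power is at most the exponential of
  \<open>n * sqrt n / 2 ^ n * L\<close>, which is below \<open>exp L\<close>; and
  \<open>exp L\<close> is at most 2 because \<open>n\<close> is positive.\<close>

lemma power_one_plus_less_two:
  fixes n D :: nat
  assumes "0 < n" and "0 < D"
  defines "L \<equiv> ln (1 + 2 powi (2 - 2 * int n)) :: real"
  shows "0 < L" and "(1 + real n / (2 ^ n * real D / (sqrt (real n) * L))) ^ D < 2"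
proof -
  have "(2::real) powi (2 - 2 * int n) \<le> 2 powi 0"
    using assms(1) by (intro power_int_increasing) auto
  then have le2: "1 + (2::real) powi (2 - 2 * int n) \<le> 2" by simp
  have pos: "(0::real) < 2 powi (2 - 2 * int n)" by simp
  then show L: "0 < L" unfolding L_def by (intro ln_gt_zero) linarith
  let ?q = "real n / (2 ^ n * real D / (sqrt (real n) * L))"
  have Dq: "real D * ?q = real n * sqrt (real n) / 2 ^ n * L"
    using assms(2) by simp
  have "(1 + ?q) ^ D \<le> exp ?q ^ D"
    using L by (intro power_mono exp_ge_add_one_self) auto
  also have "\<dots> = exp (real n * sqrt (real n) / 2 ^ n * L)"
    unfolding Dq[symmetric] by (simp only: exp_of_nat_mult)
  also have "\<dots> < exp (1 * L)"
    unfolding exp_less_cancel_iff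
    using mult_sqrt_less_two_power[OF assms(1)] L by (intro mult_strict_right_mono) auto
  also have "\<dots> = 1 + 2 powi (2 - 2 * int n)"
    using pos unfolding L_def mult_1 by (intro exp_ln) linarith
  finally show "(1 + ?q) ^ D < 2" using le2 by simp
qed

text \<open>The summand \<open>sqrt n * L\<close> in the denominator pays exactly for moving from
  \<open>x\<close> to the midpoint, a distance of at most half the diameter.\<close>

lemma C_test_of_diameter_le:
  fixes f :: "'n::finite rpoly" and J :: "(real ^ 'n) set"
  defines "L \<equiv> ln (1 + 2 powi (2 - 2 * int CARD('n))) :: real"
  assumes "is_cube J" and "x \<in> J"
    and le: "ereal (diameter J) \<le> ereal (2 * sqrt (real CARD('n)) * L) * dist_complex x f /
      ereal (2 ^ CARD('n) * real (total_degree f) + sqrt (real CARD('n)) * L)"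
  shows "C_test f J"
proof -
  let ?s = "sqrt (real CARD('n))" and ?D = "total_degree f" and ?m = "cube_midpoint J"
  let ?A = "2 ^ CARD('n) * real ?D + ?s * L"
  have "0 < L" using power_one_plus_less_two(1)[of "CARD('n)" 1] by (simp add: L_def)
  then have sL: "0 < ?s * L" and A: "0 < ?A" by (simp_all add: add_nonneg_pos)
  obtain a w where w: "0 < w" and J: "J = cbox a (a + (\<chi> i. w))"
    using \<open>is_cube J\<close> unfolding is_cube_def by blast
  have width: "cube_width J = w" and mid: "?m = a + (\<chi> i. w / 2)"
    using w by (simp_all add: J cube_width_cbox cube_midpoint_cbox)
  have "diameter J = dist a (a + (\<chi> i. w))"
    unfolding J using w by (intro diameter_cbox) (auto simp: Basis_vec_def inner_axis)
  also have "\<dots> = norm ((\<chi> i. w) :: real ^ 'n)" by (simp add: dist_norm)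
  also have "\<dots> = ?s * w" using w by (intro norm_const_vec) auto
  finally have diam: "diameter J = ?s * w" .
  have dist_x: "dist x ?m \<le> ?s * (w / 2)"
  proof -
    have "\<bar>x $ i - ?m $ i\<bar> \<le> w / 2" for i
      using \<open>x \<in> J\<close> unfolding mid
      by (auto simp: J mem_box_cart abs_le_iff field_simps dest!: spec[of _ i])
    then have "norm (x - ?m) \<le> norm ((\<chi> i. w / 2) :: real ^ 'n)"
      using w by (intro norm_le_componentwise_cart) auto
    also have "\<dots> = ?s * (w / 2)" using w by (intro norm_const_vec) auto
    finally show ?thesis by (simp add: dist_norm)
  qed
  \<comment> \<open>Fixing one zero \<open>z\<close> turns the extended-real hypothesis into a real
    inequality; if there are no zeros, the claim is vacuous.\<close>
  have far_x: "?s * w * ?A \<le> 2 * ?s * L * dist (complex_point x) z" if "z \<in> complex_zeros f" for z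
  proof -
    have "dist_complex x f \<le> ereal (dist (complex_point x) z)"
      unfolding dist_complex_def using that by (rule INF_lower)
    then have "ereal (2 * ?s * L) * dist_complex x f \<le> ereal (2 * ?s * L) * ereal (dist (complex_point x) z)"
      using \<open>0 < L\<close> by (intro ereal_mult_left_mono) auto
    then have "ereal (2 * ?s * L) * dist_complex x f / ereal ?A \<le>
        ereal (2 * ?s * L * dist (complex_point x) z) / ereal ?A"
      using A by (intro ereal_divide_right_mono) auto
    from order_trans[OF le this] have "?s * w \<le> 2 * ?s * L * dist (complex_point x) z / ?A"
      using A by (simp add: diam)
    then show ?thesis using A by (simp add: pos_le_divide_eq)
  qed
  have "centered_radius f J < \<bar>eval_rpoly f ?m\<bar>"
  \<comment> \<open>In degree 0 the ratio \<open>r\<close> would be 0. The radius is then an empty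
    sum, and a vanishing constant would put a zero at \<open>x\<close> itself, forcing the diameter
    to be at most 0.\<close>
  proof (cases "?D = 0")
    case True
    have no_zero: "eval_rpoly f ?m \<noteq> 0"
    proof
      assume "eval_rpoly f ?m = 0"
      then have "complex_point x \<in> complex_zeros f"
        using eval_rpoly_total_degree_0[OF True, of x ?m]
        by (simp add: complex_zeros_def eval_rpoly_complex_point)
      from far_x[OF this] have "?s * w * ?A \<le> 0" by simp
      moreover have "0 < ?s * w * ?A" using A w by (intro mult_pos_pos) auto
      ultimately show False by linarith
    qed
    have "{\<alpha> :: nat ^ 'n. 1 \<le> mi_degree \<alpha> \<and> mi_degree \<alpha> \<le> 0} = {}" by auto
    then show ?thesis using no_zero unfolding centered_radius_def True by (simp only: sum.empty zero_less_abs_iff not_False_eq_True)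
  next
    case False
    let ?r = "2 ^ CARD('n) * real ?D / (?s * L)"
    show ?thesis
    proof (rule centered_radius_less)
      show "0 < ?r" using False sL by simp
      show "(1 + real CARD('n) / ?r) ^ ?D < 2"
        using power_one_plus_less_two(2)[of "CARD('n)" ?D] False by (simp add: L_def)
      show "?r * (?s * (cube_width J / 2)) \<le> dist z (complex_point ?m)" if "z \<in> complex_zeros f" for z
      proof -
        have "dist (complex_point x) (complex_point ?m) \<le> ?s * (w / 2)"
        proof -
          have "complex_point x - complex_point ?m = complex_point (x - ?m)"
            by (simp add: complex_point_def vec_eq_iff)
          then show ?thesis using dist_x by (simp add: dist_norm norm_complex_point)
        qed
        then have tri: "dist (complex_point x) z \<le> dist z (complex_point ?m) + ?s * (w / 2)"
          using dist_triangle[of "complex_point x" z "complex_point ?m"] by (simp add: dist_commute)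
        have "?s * (w * ?A) \<le> ?s * (2 * L * dist (complex_point x) z)"
          using far_x[OF that] by (simp add: mult_ac)
        \<comment> \<open>On both sides the term \<open>?s * L * w\<close> appears and cancels,
          leaving the lower bound for the distance from the midpoint.\<close>
        then have "w * ?A \<le> 2 * L * dist (complex_point x) z" by simp
        also have "\<dots> \<le> 2 * L * (dist z (complex_point ?m) + ?s * (w / 2))"
          using tri \<open>0 < L\<close> by (intro mult_left_mono) auto
        finally have "2 ^ CARD('n) * real ?D * w / 2 \<le> L * dist z (complex_point ?m)"
          by (simp add: algebra_simps)
        then show ?thesis using \<open>0 < L\<close> by (simp add: width field_simps)
      qed
    qed (use w width in simp)
  qed
  moreover have "0 \<le> centered_radius f J"
    unfolding centered_radius_def width using w by (intro sum_nonneg mult_nonneg_nonneg) auto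
  ultimately show ?thesis by (intro C_testI)
qed

theorem corollary17:
  shows
    "(\<forall>(f :: 'n::finite rpoly) (J :: (real ^ 'n) set).
        is_cube J \<longrightarrow>
        (\<exists>x\<in>J. ereal (diameter J) \<le>
            ereal (2 * sqrt (real CARD('n)) * ln (1 + 2 powi (2 - 2 * int CARD('n)))) * dist_complex x f
            / ereal (2 ^ CARD('n) * real (total_degree f)
                      + sqrt (real CARD('n)) * ln (1 + 2 powi (2 - 2 * int CARD('n))))) \<longrightarrow>
        C_test f J)
     \<and> (\<exists>K :: nat \<Rightarrow> real. (\<forall>d. 0 < K d) \<and>
          (\<forall>(f :: 'n rpoly) (J :: (real ^ 'n) set).
             is_cube J \<longrightarrow>
             ereal (diameter J) < ereal (K (total_degree f)) * (SUP x\<in>J. dist_complex x f) \<longrightarrow>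
             C_test f J))"
proof (intro conjI allI impI)
  fix f :: "'n rpoly" and J :: "(real ^ 'n) set"
  assume "is_cube J" and "\<exists>x\<in>J. ereal (diameter J) \<le>
      ereal (2 * sqrt (real CARD('n)) * ln (1 + 2 powi (2 - 2 * int CARD('n)))) * dist_complex x f
      / ereal (2 ^ CARD('n) * real (total_degree f)
                + sqrt (real CARD('n)) * ln (1 + 2 powi (2 - 2 * int CARD('n))))"
  then show "C_test f J" using C_test_of_diameter_le by blast
next
  let ?s = "sqrt (real CARD('n))" and ?L = "ln (1 + 2 powi (2 - 2 * int CARD('n))) :: real"
  let ?A = "\<lambda>d. 2 ^ CARD('n) * real d + ?s * ?L"
  \<comment> \<open>The factor of \<open>dist_complex x f\<close> in the first part, as a function
    of the degree; its denominator is positive even in degree 0.\<close>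
  let ?K = "\<lambda>d. 2 * ?s * ?L / ?A d"
  have "0 < ?L" using power_one_plus_less_two(1)[of "CARD('n)" 1] by simp
  then have A: "0 < ?A d" for d by (simp add: add_nonneg_pos)
  have "C_test f J" if "is_cube J"
    and less: "ereal (diameter J) < ereal (?K (total_degree f)) * (SUP x\<in>J. dist_complex x f)"
    for f :: "'n rpoly" and J :: "(real ^ 'n) set"
  proof -
    obtain a w where w: "0 < w" and J: "J = cbox a (a + (\<chi> i. w))"
      using \<open>is_cube J\<close> unfolding is_cube_def by blast
    have "a \<in> J" using w by (simp add: J mem_box_cart)
    then have "compact J" "J \<noteq> {}" by (auto simp: J)
    \<comment> \<open>Since the maximum is attained, the hypothesis becomes one about a single point
      of the cube and the first part applies.\<close>
    then obtain x where "x \<in> J" and x: "dist_complex x f = (SUP y\<in>J. dist_complex y f)"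
      using SUP_dist_complex_attained by blast
    have "ereal (?K (total_degree f)) * dist_complex x f =
        ereal (2 * ?s * ?L) * dist_complex x f / ereal (?A (total_degree f))"
      using A[of "total_degree f"] \<open>0 < ?L\<close>
      by (cases "dist_complex x f") (simp_all add: ereal_divide divide_simps)
    then show ?thesis
      using C_test_of_diameter_le[OF \<open>is_cube J\<close> \<open>x \<in> J\<close>, of f] less x by simp
  qed
  moreover have "0 < ?K d" for d using A[of d] \<open>0 < ?L\<close> by simp
  ultimately show "\<exists>K :: nat \<Rightarrow> real. (\<forall>d. 0 < K d) \<and>
      (\<forall>(f :: 'n rpoly) (J :: (real ^ 'n) set). is_cube J \<longrightarrow>
         ereal (diameter J) < ereal (K (total_degree f)) * (SUP x\<in>J. dist_complex x f) \<longrightarrow>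
         C_test f J)"
    by (intro exI[of _ ?K]) blast
qed

end
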